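(* Let $M,N\in\mathbb{S}^{q+r}$. If there exist scalars $\alpha\ge 0$ and $\beta>0$ such that $M-\alpha N\ge\begin{bmatrix}\beta I_q&0\\0&0\end{bmatrix}$ ( * ), then $\mathcal{Z}_r(N)\subseteq\mathcal{Z}_r^+(M)$. Moreover, if $N\in\boldsymbol{\Pi}_{q,r}$ and $M_{22}\le 0$, then $\mathcal{Z}_r(N)\subseteq\mathcal{Z}_r^+(M)$ if and only if there exist $\alpha\ge 0$ and $\beta>0$ such that ( * ) holds.
   Context: $\mathbb{S}^k$ denotes the real symmetric $k\times k$ matrices; for symmetric matrices, $A\ge 0$ ($A>0$) means positive semidefinite (definite), $A\le B$ means $B-A\ge0$. $A^\dagger$ is the Moore–Penrose pseudo-inverse. Any $\Pi\in\mathbb{S}^{q+r}$ (in particular $M,N$) is partitioned as $\Pi=\begin{bmatrix}\Pi_{11}&\Pi_{12}\\ \Pi_{21}&\Pi_{22}\end{bmatrix}$ with $\Pi_{11}\in\mathbb{S}^q$, $\Pi_{22}\in\mathbb{S}^r$. The generalized Schur complement is $\Pi\mid\Pi_{22}:=\Pi_{11}-\Pi_{12}\Pi_{22}^\dagger\Pi_{21}$. The set $\boldsymbol{\Pi}_{q,r}$ consists of all $\Pi\in\mathbb{S}^{q+r}$ with $\Pi_{22}\le 0$, $\Pi\mid\Pi_{22}\ge 0$ and $\ker\Pi_{22}\subseteq\ker\Pi_{12}$. Define $\mathcal{Z}_r(\Pi)=\{Z\in\mathbb{R}^{r\times q}:\begin{bmatrix}I_q\\ Z\end{bmatrix}^\top\Pi\begin{bmatrix}I_q\\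 Z\end{bmatrix}\ge 0\}$ and $\mathcal{Z}_r^+(\Pi)$ the same with $>0$. *)

theory Defs
  imports "HOL-Analysis.Analysis"
begin

text \<open>Matrices in S^(q+r) are represented as real^('q::finite+'r::finite)^('q+'r); the index type
  'q + 'r (disjoint sum) gives the block partition: Inl indices are the first q,
  Inr indices the last r coordinates.\<close>

definition symmetric_mat :: "real^'n^'n \<Rightarrow> bool" where
  "symmetric_mat A \<longleftrightarrow> transpose A = A"

definition psd :: "real^'n^'n \<Rightarrow> bool" where
  "psd A \<longleftrightarrow> (\<forall>x. 0 \<le> x \<bullet> (A *v x))"

definition pd :: "real^'n^'n \<Rightarrow> bool" where
  "pd A \<longleftrightarrow> (\<forall>x. x \<noteq> 0 \<longrightarrow> 0 < x \<bullet> (A *v x))"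

text \<open>Loewner order A \<le> B iff B - A is positive semidefinite.\<close>
definition loewner_le :: "real^'n^'n \<Rightarrow> real^'n^'n \<Rightarrow> bool" where
  "loewner_le A B \<longleftrightarrow> psd (B - A)"

text \<open>Moore-Penrose pseudo-inverse, defined by the four Penrose conditions.\<close>
definition pinv :: "real^'n^'m \<Rightarrow> real^'m^'n" where
  "pinv A = (THE X. A ** X ** A = A \<and> X ** A ** X = X \<and>
              transpose (A ** X) = A ** X \<and> transpose (X ** A) = X ** A)"

definition blk11 :: "real^('q::finite+'r::finite)^('q+'r) \<Rightarrow> real^'q^'q" where
  "blk11 P = (\<chi> i j. P $ Inl i $ Inl j)"
definition blk12 :: "real^('q::finite+'r::finite)^('q+'r) \<Rightarrow> real^'r^'q" where
  "blk12 P = (\<chi> i j. P $ Inl i $ Inr j)"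
definition blk21 :: "real^('q::finite+'r::finite)^('q+'r) \<Rightarrow> real^'q^'r" where
  "blk21 P = (\<chi> i j. P $ Inr i $ Inl j)"
definition blk22 :: "real^('q::finite+'r::finite)^('q+'r) \<Rightarrow> real^'r^'r" where
  "blk22 P = (\<chi> i j. P $ Inr i $ Inr j)"

text \<open>Generalized Schur complement P | P22.\<close>
definition schur :: "real^('q::finite+'r::finite)^('q+'r) \<Rightarrow> real^'q^'q" where
  "schur P = blk11 P - blk12 P ** pinv (blk22 P) ** blk21 P"

definition ker_mat :: "real^'n^'m \<Rightarrow> (real^'n) set" where
  "ker_mat A = {x. A *v x = 0}"

text \<open>The set Pi_{q,r}.\<close>
definition PiSet :: "(real^('q::finite+'r::finite)^('q+'r)) set" where
  "PiSet = {P. symmetric_mat P \<and> loewner_le (blk22 P) 0 \<and> psd (schur P) \<and>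
              ker_mat (blk22 P) \<subseteq> ker_mat (blk12 P)}"

text \<open>The matrix [I_q; Z].\<close>
definition stackI :: "real^'q^'r \<Rightarrow> real^'q^('q+'r)" where
  "stackI Z = (\<chi> i j. case i of Inl a \<Rightarrow> (mat 1 :: real^'q^'q) $ a $ j | Inr b \<Rightarrow> Z $ b $ j)"

definition Zr :: "real^('q::finite+'r::finite)^('q+'r) \<Rightarrow> (real^'q^'r) set" where
  "Zr P = {Z. psd (transpose (stackI Z) ** P ** stackI Z)}"

definition Zr_plus :: "real^('q::finite+'r::finite)^('q+'r) \<Rightarrow> (real^'q^'r) set" where
  "Zr_plus P = {Z. pd (transpose (stackI Z) ** P ** stackI Z)}"

text \<open>The block matrix [beta I_q, 0; 0, 0].\<close>
definition blkdiagI :: "real \<Rightarrow> real^('q::finite+'r::finite)^('q+'r)" where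
  "blkdiagI \<beta> = (\<chi> i j. case (i, j) of (Inl a, Inl b) \<Rightarrow> (if a = b then \<beta> else 0) | _ \<Rightarrow> 0)"

end

theory Submission
  imports Defs
begin

text \<open>Along the graph of Z, i.e. for vectors [x; Z x], condition (*) gives
  [x; Zx]'M[x; Zx] \<ge> \<alpha> [x; Zx]'N[x; Zx] + \<beta>|x|^2, which is positive for x \<noteq> 0 whenever
  Z \<in> Z_r(N); this is the sufficiency.

  For the converse, N \<in> \<Pi> lets every [x; y] with x \<noteq> 0 and [x; y]'N[x; y] \<ge> 0 be written as
  [x; Zx] for some Z \<in> Z_r(N) (a rank-one correction of -N22\<dagger> N21, via the generalised Schur
  complement), so the inclusion makes the M-form positive there. Together with M22 \<le> 0 this
  forces ker N22 \<subseteq> ker M22 \<inter> ker M12, so both forms only depend on the component of y in the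
  range of N22. On that subspace the N-form is nonnegative only where x \<noteq> 0, hence the M-form
  is strictly positive on the compact set of unit vectors where the N-form is nonnegative,
  which yields \<beta>. Finally \<alpha> is a Lagrange multiplier: the S-lemma provides it when N takes
  positive values, and compactness of the unit sphere when it does not.\<close>

definition qform :: "real^'n^'n \<Rightarrow> real^'n \<Rightarrow> real" where
  "qform A x = x \<bullet> (A *v x)"

lemma inner_matrix_transpose: "(u::real^'m) \<bullet> (A *v w) = (transpose A *v u) \<bullet> (w::real^'n)"
  by (simp add: dot_lmul_matrix)

lemma symmetric_mat_inner_commute:
  "symmetric_mat A \<Longrightarrow> (u::real^'n) \<bullet> (A *v w) = w \<bullet> (A *v u)"
  unfolding symmetric_mat_def by (metis inner_matrix_transpose inner_commute)

lemma matrix_eqI_inner: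
  fixes A B :: "real^'n^'m"
  assumes "\<And>u v. u \<bullet> (A *v v) = u \<bullet> (B *v v)"
  shows "A = B"
proof (rule matrix_eq[THEN iffD2], rule allI)
  fix v
  have "(A *v v - B *v v) \<bullet> (A *v v - B *v v) = 0"
    using assms[of "A *v v - B *v v" v] by (simp add: inner_diff_right)
  then show "A *v v = B *v v" by simp
qed

lemma symmetric_matI_inner:
  fixes A :: "real^'n^'n"
  assumes "\<And>u v. u \<bullet> (A *v v) = (A *v u) \<bullet> v"
  shows "symmetric_mat A"
  unfolding symmetric_mat_def
  by (rule matrix_eqI_inner) (metis assms inner_matrix_transpose inner_commute)

lemma symmetric_mat_diff:
  "symmetric_mat A \<Longrightarrow> symmetric_mat B \<Longrightarrow> symmetric_mat (A - B :: real^'n^'n)"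
  by (simp add: symmetric_mat_def vec_eq_iff transpose_def)

lemma qform_scaleR: "qform A (c *\<^sub>R x) = c\<^sup>2 * qform A x"
  by (simp add: qform_def matrix_vector_mult_scaleR power2_eq_square)

lemma qform_add:
  "symmetric_mat A \<Longrightarrow> qform A (x + y) = qform A x + 2 * (x \<bullet> (A *v y)) + qform A y"
  using symmetric_mat_inner_commute[of A x y]
  by (simp add: qform_def matrix_vector_right_distrib inner_add_left inner_add_right)

lemma qform_add_scaleR:
  "symmetric_mat A \<Longrightarrow>
     qform A (x + t *\<^sub>R y) = qform A x + 2 * t * (x \<bullet> (A *v y)) + t\<^sup>2 * qform A y"
  by (simp add: qform_add qform_scaleR matrix_vector_mult_scaleR)

lemma qform_diff_matrix: "qform (A - B) x = qform A x - qform B x"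
  by (simp add: qform_def matrix_vector_mult_diff_rdistrib inner_diff_right)

lemma qform_scaleR_matrix: "qform (c *\<^sub>R A) x = c * qform A x"
  by (simp add: qform_def flip: scaleR_matrix_vector_assoc)

lemma qform_congruence: "qform (transpose T ** P ** T) x = qform P (T *v x)"
  unfolding qform_def matrix_vector_mul_assoc[symmetric]
  by (metis inner_matrix_transpose transpose_transpose)

lemma continuous_on_qform: "continuous_on S (qform A)"
  unfolding qform_def
  by (intro continuous_on_inner continuous_on_id matrix_vector_mult_linear_continuous_on)

lemma psd_iff_qform: "psd A \<longleftrightarrow> (\<forall>x. qform A x \<ge> 0)"
  by (simp add: psd_def qform_def)

lemma loewner_le_zero_iff: "loewner_le A 0 \<longleftrightarrow> (\<forall>x. qform A x \<le> 0)"
proof -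
  have "(- A) *v x = - (A *v x)" for x
    by (simp add: matrix_vector_mult_def vec_eq_iff sum_negf)
  then show ?thesis by (simp add: loewner_le_def psd_def qform_def)
qed

definition penrose_inverse :: "real^'n^'m \<Rightarrow> real^'m^'n \<Rightarrow> bool" where
  "penrose_inverse A X \<longleftrightarrow> A ** X ** A = A \<and> X ** A ** X = X \<and>
     symmetric_mat (A ** X) \<and> symmetric_mat (X ** A)"

lemma penrose_inverse_unique:
  assumes "penrose_inverse A X" "penrose_inverse A Y"
  shows "X = Y"
proof -
  have a1: "A ** X ** A = A" and a2: "X ** A ** X = X" and a3: "transpose (A ** X) = A ** X"
    and a4: "transpose (X ** A) = X ** A"
    and b1: "A ** Y ** A = A" and b2: "Y ** A ** Y = Y" and b3: "transpose (A ** Y) = A ** Y"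
    and b4: "transpose (Y ** A) = Y ** A"
    using assms by (auto simp: penrose_inverse_def symmetric_mat_def)
  have "X = X ** transpose (A ** X)" using a2 a3 by (simp add: matrix_mul_assoc)
  also have "\<dots> = X ** transpose X ** transpose (A ** Y ** A)"
    using b1 by (simp add: matrix_transpose_mul matrix_mul_assoc)
  also have "\<dots> = X ** (transpose (A ** X) ** transpose (A ** Y))"
    by (simp add: matrix_transpose_mul matrix_mul_assoc)
  also have "\<dots> = X ** A ** Y" using a3 b3 a1 by (metis matrix_mul_assoc)
  finally have X: "X = X ** A ** Y" .
  have "Y = transpose (Y ** A) ** Y" using b2 b4 by simp
  also have "\<dots> = transpose (A ** X ** A) ** transpose Y ** Y"
    using a1 by (simp add: matrix_transpose_mul)
  also have "\<dots> = (transpose (X ** A) ** transpose (Y ** A)) ** Y"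
    by (simp add: matrix_transpose_mul matrix_mul_assoc)
  also have "\<dots> = X ** A ** Y" using a4 b4 b2 by (metis matrix_mul_assoc)
  finally show ?thesis using X by simp
qed

lemma pinv_eqI:
  assumes "penrose_inverse A X"
  shows "pinv A = X"
proof -
  have "penrose_inverse A Y \<longleftrightarrow> A ** Y ** A = A \<and> Y ** A ** Y = Y \<and>
      transpose (A ** Y) = A ** Y \<and> transpose (Y ** A) = Y ** A" for Y
    by (simp add: penrose_inverse_def symmetric_mat_def)
  then have "pinv A = (THE Y. penrose_inverse A Y)" by (simp add: pinv_def)
  also have "\<dots> = X"
    by (rule the_equality) (use assms penrose_inverse_unique in blast)+
  finally show ?thesis .
qed

lemma symmetric_mat_kernel_orthogonal_range:
  "symmetric_mat A \<Longrightarrow> A *v k = 0 \<Longrightarrow> k \<bullet> (A *v u) = 0"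
  by (metis symmetric_mat_inner_commute inner_zero_right)

lemma symmetric_mat_range_kernel_decomp:
  fixes A :: "real^'n^'n"
  assumes A: "symmetric_mat A"
  shows "\<exists>u. A *v (y - A *v u) = 0"
proof -
  let ?V = "range ((*v) A)"
  have span: "span ?V = ?V"
    by (simp add: span_eq_iff linear_subspace_image[OF matrix_vector_mul_linear subspace_UNIV])
  obtain y1 y2 where y1: "y1 \<in> ?V" and y2: "\<And>w. w \<in> ?V \<Longrightarrow> orthogonal y2 w"
    and y: "y = y1 + y2"
    using orthogonal_subspace_decomp_exists[of ?V y] unfolding span by blast
  have "(A *v y2) \<bullet> (A *v y2) = y2 \<bullet> (A *v (A *v y2))"
    using symmetric_mat_inner_commute[OF A] by metis
  also have "\<dots> = 0" using y2 by (simp add: orthogonal_def)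
  finally have "A *v y2 = 0" by simp
  moreover obtain u where "y1 = A *v u" using y1 by blast
  ultimately have "A *v (y - A *v u) = 0" using y by simp
  then show ?thesis ..
qed

lemma symmetric_mat_range_inter_kernel:
  "symmetric_mat A \<Longrightarrow> A *v (A *v u) = 0 \<Longrightarrow> A *v u = 0"
  using symmetric_mat_kernel_orthogonal_range[of A "A *v u" u] by simp

lemma symmetric_mat_left_inverse_on_range:
  fixes A :: "real^'n^'n"
  assumes A: "symmetric_mat A"
  obtains g where "linear g" "range g \<subseteq> range ((*v) A)"
    "\<And>c. c \<in> range ((*v) A) \<Longrightarrow> g (A *v c) = c"
    "\<And>c. c \<in> range ((*v) A) \<Longrightarrow> A *v g c = c"
proof -
  let ?V = "range ((*v) A)"
  have V: "subspace ?V"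
    by (rule linear_subspace_image[OF matrix_vector_mul_linear subspace_UNIV])
  then have span: "span ?V = ?V" by (rule span_eq_iff[THEN iffD2])
  have "inj_on ((*v) A) ?V"
    unfolding linear_inj_on_iff_eq_0[OF matrix_vector_mul_linear V]
  proof (intro ballI impI)
    fix c assume "c \<in> ?V" "A *v c = 0"
    then show "c = 0" using symmetric_mat_range_inter_kernel[OF A] by blast
  qed
  then obtain g where g: "range g \<subseteq> ?V" "linear g" and g_inv: "\<And>c. c \<in> ?V \<Longrightarrow> g (A *v c) = c"
    using linear_inj_on_left_inverse[OF matrix_vector_mul_linear, of A ?V] unfolding span by meson
  have "A *v g c = c" if "c \<in> ?V" for c
  proof -
    obtain u where c: "c = A *v u" using \<open>c \<in> ?V\<close> by blast
    obtain w where "A *v (u - A *v w) = 0" using symmetric_mat_range_kernel_decomp[OF A] by blast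
    then have "c = A *v (A *v w)" using c by (simp add: matrix_vector_mult_diff_distrib)
    then show ?thesis using g_inv by simp
  qed
  then show ?thesis using that g g_inv by blast
qed

text \<open>With g a linear left inverse of A on its range, p = g \<circ> A is the orthogonal projection
  onto the range, and X = g \<circ> p satisfies A X = X A = p.\<close>

lemma symmetric_mat_penrose_inverse_exists:
  fixes A :: "real^'n^'n"
  assumes A: "symmetric_mat A"
  shows "\<exists>X. penrose_inverse A X"
proof -
  let ?V = "range ((*v) A)"
  obtain g where g_lin: "linear g" and g_range: "range g \<subseteq> ?V"
    and g_inv: "\<And>c. c \<in> ?V \<Longrightarrow> g (A *v c) = c" and A_g: "\<And>c. c \<in> ?V \<Longrightarrow> A *v g c = c"
    using symmetric_mat_left_inverse_on_range[OF A] by blast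
  define p where "p b = g (A *v b)" for b
  have p_range: "p b \<in> ?V" for b using g_range unfolding p_def by blast
  have p_id: "p c = c" if "c \<in> ?V" for c using that g_inv unfolding p_def by blast
  have p_symm: "u \<bullet> p v = p u \<bullet> p v" for u v
  proof -
    have "A *v (u - p u) = 0"
      using A_g[OF rangeI] by (simp add: p_def matrix_vector_mult_diff_distrib)
    moreover obtain w where "p v = A *v w" using p_range by blast
    ultimately have "(u - p u) \<bullet> p v = 0" using symmetric_mat_kernel_orthogonal_range[OF A] by simp
    then show ?thesis by (simp add: inner_diff_left)
  qed
  have "linear (\<lambda>b. g (p b))"
    using linear_compose[OF linear_compose[OF matrix_vector_mul_linear g_lin] g_lin]
    by (simp add: comp_def p_def)
  define X where "X = matrix (\<lambda>b. g (p b))"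
  have X: "X *v b = g (p b)" for b
    unfolding X_def by (metis \<open>linear (\<lambda>b. g (p b))\<close> matrix_vector_mul(2))
  have XA: "(X ** A) *v b = p b" for b
    using p_id[of "A *v b"] by (simp add: X p_def flip: matrix_vector_mul_assoc)
  have AX: "(A ** X) *v b = p b" for b
    using A_g[OF p_range] by (simp add: X flip: matrix_vector_mul_assoc)
  have "symmetric_mat (A ** X)" "symmetric_mat (X ** A)"
    by (rule symmetric_matI_inner, metis AX XA p_symm inner_commute)+
  moreover have "A ** X ** A = A"
    unfolding matrix_eq using AX p_id by (simp flip: matrix_vector_mul_assoc)
  moreover have "X ** A ** X = X"
    unfolding matrix_eq using XA p_id g_range by (simp add: X image_subset_iff flip: matrix_vector_mul_assoc)
  ultimately show ?thesis unfolding penrose_inverse_def by blast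
qed

lemma pinv_symmetric_mat:
  fixes A :: "real^'n^'n"
  assumes A: "symmetric_mat A"
  shows "A ** pinv A ** A = A" "symmetric_mat (pinv A)"
proof -
  obtain X where X: "penrose_inverse A X" using symmetric_mat_penrose_inverse_exists[OF A] ..
  have "penrose_inverse A (transpose X)"
    using X A unfolding penrose_inverse_def symmetric_mat_def
    by (metis matrix_transpose_mul matrix_mul_assoc transpose_transpose)
  then have "transpose X = X" using penrose_inverse_unique[OF _ X] by blast
  then show "A ** pinv A ** A = A" "symmetric_mat (pinv A)"
    using X pinv_eqI[OF X] unfolding penrose_inverse_def symmetric_mat_def by auto
qed

definition vfst :: "real^('q::finite+'r::finite) \<Rightarrow> real^'q" where
  "vfst v = (\<chi> i. v $ Inl i)"

definition vsnd :: "real^('q::finite+'r::finite) \<Rightarrow> real^'r" where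
  "vsnd v = (\<chi> j. v $ Inr j)"

definition vpair :: "real^'q::finite \<Rightarrow> real^'r::finite \<Rightarrow> real^('q+'r)" where
  "vpair x y = (\<chi> k. case k of Inl i \<Rightarrow> x $ i | Inr j \<Rightarrow> y $ j)"

lemma vfst_vpair [simp]: "vfst (vpair x y) = x"
  and vsnd_vpair [simp]: "vsnd (vpair x y) = y"
  by (simp_all add: vfst_def vsnd_def vpair_def vec_eq_iff)

lemma vpair_vfst_vsnd [simp]: "vpair (vfst v) (vsnd v) = v"
  by (simp add: vfst_def vsnd_def vpair_def vec_eq_iff split: sum.splits)

lemma vpair_eq_0_iff [simp]: "vpair x y = 0 \<longleftrightarrow> x = 0 \<and> y = 0"
  by (auto simp: vpair_def vec_eq_iff split: sum.splits)

lemma vfst_add [simp]: "vfst (u + v) = vfst u + vfst v"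
  and vsnd_add [simp]: "vsnd (u + v) = vsnd u + vsnd v"
  and vfst_scaleR [simp]: "vfst (c *\<^sub>R u) = c *\<^sub>R vfst u"
  and vsnd_scaleR [simp]: "vsnd (c *\<^sub>R u) = c *\<^sub>R vsnd u"
  by (simp_all add: vfst_def vsnd_def vec_eq_iff)

lemma sum_UNIV_Plus:
  fixes f :: "'q::finite + 'r::finite \<Rightarrow> 'a::comm_monoid_add"
  shows "(\<Sum>k\<in>UNIV. f k) = (\<Sum>i\<in>UNIV. f (Inl i)) + (\<Sum>j\<in>UNIV. f (Inr j))"
  by (subst UNIV_Plus_UNIV[symmetric], subst sum.Plus) (auto simp: comp_def)

lemma inner_vfst_vsnd: "u \<bullet> v = vfst u \<bullet> vfst v + vsnd u \<bullet> vsnd v"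
  by (simp add: inner_vec_def sum_UNIV_Plus vfst_def vsnd_def)

lemma vfst_matrix_vector_mult: "vfst (P *v v) = blk11 P *v vfst v + blk12 P *v vsnd v"
  by (simp add: vec_eq_iff vfst_def vsnd_def blk11_def blk12_def matrix_vector_mult_def sum_UNIV_Plus)

lemma vsnd_matrix_vector_mult: "vsnd (P *v v) = blk21 P *v vfst v + blk22 P *v vsnd v"
  by (simp add: vec_eq_iff vfst_def vsnd_def blk21_def blk22_def matrix_vector_mult_def sum_UNIV_Plus)

lemma symmetric_mat_blocks:
  assumes "symmetric_mat P"
  shows "transpose (blk12 P) = blk21 P" "symmetric_mat (blk22 P)"
  using assms unfolding symmetric_mat_def
  by (auto simp: blk12_def blk21_def blk22_def transpose_def vec_eq_iff)

lemma qform_vpair: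
  assumes "symmetric_mat P"
  shows "qform P (vpair x y) = qform (blk11 P) x + 2 * (x \<bullet> (blk12 P *v y)) + qform (blk22 P) y"
proof -
  have "y \<bullet> (blk21 P *v x) = x \<bullet> (blk12 P *v y)"
    by (metis inner_matrix_transpose inner_commute symmetric_mat_blocks(1)[OF assms])
  then show ?thesis
    by (simp add: qform_def inner_vfst_vsnd[of "vpair x y"] vfst_matrix_vector_mult
        vsnd_matrix_vector_mult inner_add_right)
qed

lemma qform_vpair_add_kernel:
  assumes P: "symmetric_mat P" and "blk12 P *v k = 0" "blk22 P *v k = 0"
  shows "qform P (vpair x (y + k)) = qform P (vpair x y)"
proof -
  have "y \<bullet> (blk22 P *v k) = 0" using assms by simp
  then have "k \<bullet> (blk22 P *v y) = 0"
    by (metis symmetric_mat_inner_commute symmetric_mat_blocks(2)[OF P])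
  then show ?thesis
    using assms unfolding qform_vpair[OF P] qform_add[OF symmetric_mat_blocks(2)[OF P]]
    by (simp add: matrix_vector_right_distrib qform_def)
qed

lemma stackI_mult_vector: "stackI Z *v x = vpair x (Z *v x)"
proof -
  have "(stackI Z *v x) $ k = vpair x (Z *v x) $ k" for k
    by (cases k) (simp_all add: stackI_def vpair_def matrix_vector_mult_def mat_def
        if_distrib if_distribR sum.delta cong: if_cong)
  then show ?thesis by (simp add: vec_eq_iff)
qed

lemma qform_stackI: "qform (transpose (stackI Z) ** P ** stackI Z) x = qform P (vpair x (Z *v x))"
  by (simp add: qform_congruence stackI_mult_vector)

lemma blkdiagI_mult_vector: "blkdiagI b *v v = vpair (b *\<^sub>R vfst v) 0"
proof -
  have "(blkdiagI b *v v) $ k = vpair (b *\<^sub>R vfst v) 0 $ k" for k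
    by (cases k) (simp_all add: blkdiagI_def vpair_def vfst_def matrix_vector_mult_def
        sum_UNIV_Plus if_distrib if_distribR sum.delta cong: if_cong)
  then show ?thesis by (simp add: vec_eq_iff)
qed

lemma qform_blkdiagI: "qform (blkdiagI b) v = b * (vfst v \<bullet> vfst v)"
  by (simp add: qform_def blkdiagI_mult_vector inner_vfst_vsnd[of v])

lemma symmetric_mat_blkdiagI: "symmetric_mat (blkdiagI b)"
  by (auto simp: symmetric_mat_def vec_eq_iff transpose_def blkdiagI_def split: sum.splits)

lemma loewner_le_blkdiagI_iff:
  "loewner_le (blkdiagI b) (M - a *\<^sub>R N) \<longleftrightarrow>
     (\<forall>v. a * qform N v + b * (vfst v \<bullet> vfst v) \<le> qform M v)"
  unfolding loewner_le_def psd_iff_qform qform_diff_matrix qform_scaleR_matrix qform_blkdiagI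
  by (auto simp: algebra_simps)

lemma Zr_subset_Zr_plus_if_loewner_le:
  assumes "a \<ge> 0" "b > 0" "loewner_le (blkdiagI b) (M - a *\<^sub>R N)"
  shows "Zr N \<subseteq> Zr_plus M"
proof
  fix Z assume "Z \<in> Zr N"
  then have N: "qform N (vpair x (Z *v x)) \<ge> 0" for x
    by (simp add: Zr_def psd_iff_qform qform_stackI)
  have "qform M (vpair x (Z *v x)) > 0" if "x \<noteq> 0" for x
    using assms N[of x] that loewner_le_blkdiagI_iff[THEN iffD1, OF assms(3), rule_format, of "vpair x (Z *v x)"]
    by (smt (verit) mult_nonneg_nonneg mult_pos_pos inner_gt_zero_iff vfst_vpair)
  then show "Z \<in> Zr_plus M"
    by (simp add: Zr_plus_def pd_def qform_stackI[unfolded qform_def, symmetric] qform_def)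
qed

lemma quadratic_pos_nonpos_lead_imp_const:
  fixes a b c :: real
  assumes pos: "\<And>t. a + 2 * b * t + c * t\<^sup>2 > 0" and c: "c \<le> 0"
  shows "c = 0 \<and> b = 0"
proof -
  have "c = 0"
  proof (rule ccontr)
    assume "c \<noteq> 0"
    define s where "s = sqrt ((\<bar>a\<bar> + 1) / - c)"
    have "s\<^sup>2 = (\<bar>a\<bar> + 1) / - c"
      unfolding s_def using c by (intro real_sqrt_pow2) (simp add: divide_nonneg_nonpos)
    then have "c * s\<^sup>2 = - (\<bar>a\<bar> + 1)"
      using \<open>c \<noteq> 0\<close> by simp
    moreover have "0 < a + 2 * b * s + c * s\<^sup>2" "0 < a - 2 * b * s + c * s\<^sup>2"
      using pos[of s] pos[of "- s"] by simp_all
    ultimately show False using abs_ge_self[of a] by linarith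
  qed
  moreover have "b = 0"
  proof (rule ccontr)
    assume "b \<noteq> 0"
    define t where "t = - (\<bar>a\<bar> + 1) / (2 * b)"
    have "a + 2 * b * t + c * t\<^sup>2 = a - (\<bar>a\<bar> + 1)"
      using \<open>b \<noteq> 0\<close> \<open>c = 0\<close> by (simp add: t_def field_simps)
    then show False using pos[of t] abs_ge_self[of a] by linarith
  qed
  ultimately show ?thesis ..
qed

lemma quadratic_roots_opposite_sign:
  fixes a0 am a2 :: real
  assumes a0: "a0 > 0" and a2: "a2 < 0"
  obtains t1 t2 where "t1 < 0" "t2 > 0"
    "a0 + 2 * am * t1 + a2 * t1\<^sup>2 = 0" "a0 + 2 * am * t2 + a2 * t2\<^sup>2 = 0"
proof -
  define s where "s = sqrt (am\<^sup>2 - a0 * a2)"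
  have "a0 * a2 < 0" using a0 a2 by (rule mult_pos_neg)
  then have s2: "s\<^sup>2 = am\<^sup>2 - a0 * a2"
    unfolding s_def by (intro real_sqrt_pow2) (smt (verit) zero_le_power2)
  have "am\<^sup>2 < am\<^sup>2 - a0 * a2" using \<open>a0 * a2 < 0\<close> by simp
  then have s: "s > \<bar>am\<bar>" unfolding s_def by (metis real_sqrt_abs real_sqrt_less_mono)
  define t1 where "t1 = (s - am) / a2"
  define t2 where "t2 = - (am + s) / a2"
  have "t1 < 0" "t2 > 0"
    using s a2 by (auto simp: t1_def t2_def divide_pos_neg divide_neg_neg)
  moreover have "a0 + 2 * am * t1 + a2 * t1\<^sup>2 = 0"
    unfolding t1_def using a2 s2 by (simp add: field_simps power2_eq_square) algebra
  moreover have "a0 + 2 * am * t2 + a2 * t2\<^sup>2 = 0"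
    unfolding t2_def using a2 s2 by (simp add: field_simps power2_eq_square) algebra
  ultimately show ?thesis by (rule that)
qed

text \<open>If l lies strictly between the two ratios, the quadratic h - l a is nonnegative at the
  roots t1 < 0 < t2 of a, but its constant and leading coefficients are negative;
  interpolating its value at 0 from those at t1 and t2 gives a contradiction.\<close>

lemma quadratic_implication_ratio_le:
  fixes a0 am a2 h0 hm h2 :: real
  assumes a0: "a0 > 0" and a2: "a2 < 0"
    and imp: "\<And>t. a0 + 2 * am * t + a2 * t\<^sup>2 \<ge> 0 \<Longrightarrow> h0 + 2 * hm * t + h2 * t\<^sup>2 \<ge> 0"
  shows "h2 / a2 \<le> h0 / a0"
proof (rule ccontr)
  assume "\<not> h2 / a2 \<le> h0 / a0"
  define l where "l = (h0 / a0 + h2 / a2) / 2"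
  have "h0 / a0 < l" and "l < h2 / a2"
    using \<open>\<not> h2 / a2 \<le> h0 / a0\<close> field_sum_of_halves[of "h0 / a0"] field_sum_of_halves[of "h2 / a2"]
    unfolding l_def by (simp_all add: add_divide_distrib)
  then have k0: "h0 - l * a0 < 0" and k2: "h2 - l * a2 < 0"
    using a0 a2 by (auto simp: field_simps)
  obtain t1 t2 where t1: "t1 < 0" and t2: "t2 > 0"
    and roots: "\<And>t. t = t1 \<or> t = t2 \<Longrightarrow> a0 + 2 * am * t + a2 * t\<^sup>2 = 0"
    using quadratic_roots_opposite_sign[OF a0 a2, of am] by metis
  define k where "k t = (h0 - l * a0) + 2 * (hm - l * am) * t + (h2 - l * a2) * t\<^sup>2" for t
  have "k t = (h0 + 2 * hm * t + h2 * t\<^sup>2) - l * (a0 + 2 * am * t + a2 * t\<^sup>2)" for t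
    by (simp add: k_def algebra_simps)
  then have "k t \<ge> 0" if "t = t1 \<or> t = t2" for t
    using imp[of t] roots[OF that] by simp
  moreover have "(t2 - t1) * (h0 - l * a0) = t2 * k t1 - t1 * k t2 + (h2 - l * a2) * t1 * t2 * (t2 - t1)"
    unfolding k_def by (simp add: algebra_simps power2_eq_square)
  moreover have "(h2 - l * a2) * t1 * t2 * (t2 - t1) > 0"
    using k2 t1 t2 by (simp add: mult_neg_neg)
  ultimately have "(t2 - t1) * (h0 - l * a0) > 0"
    using t1 t2 by (smt (verit) mult_nonneg_nonneg mult_nonpos_nonneg)
  moreover have "(t2 - t1) * (h0 - l * a0) < 0" using t1 t2 k0 by (simp add: mult_pos_neg)
  ultimately show False by linarith
qed

lemma S_lemma:
  fixes A H :: "real^'n^'n"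
  assumes A: "symmetric_mat A" and H: "symmetric_mat H"
    and slater: "\<exists>u. qform A u > 0"
    and imp: "\<And>v. qform A v \<ge> 0 \<Longrightarrow> qform H v \<ge> 0"
  shows "\<exists>a\<ge>0. \<forall>v. a * qform A v \<le> qform H v"
proof -
  define R where "R = {qform H u / qform A u | u. qform A u > 0}"
  define a where "a = Inf R"
  have R_ne: "R \<noteq> {}" using slater unfolding R_def by auto
  have R_nonneg: "r \<ge> 0" if "r \<in> R" for r
    using that imp unfolding R_def by (auto intro!: divide_nonneg_pos)
  have a: "a \<ge> 0" unfolding a_def using R_ne R_nonneg by (intro cInf_greatest) auto
  have ratio_le: "qform H w / qform A w \<le> qform H u / qform A u"
    if u: "qform A u > 0" and w: "qform A w < 0" for u w
  proof (rule quadratic_implication_ratio_le[OF u w])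
    fix t :: real
    assume "qform A u + 2 * (u \<bullet> (A *v w)) * t + qform A w * t\<^sup>2 \<ge> 0"
    then have "qform H (u + t *\<^sub>R w) \<ge> 0" by (intro imp) (simp add: qform_add_scaleR[OF A] ac_simps)
    then show "qform H u + 2 * (u \<bullet> (H *v w)) * t + qform H w * t\<^sup>2 \<ge> 0"
      by (simp add: qform_add_scaleR[OF H] ac_simps)
  qed
  have "a * qform A v \<le> qform H v" for v
  proof (cases "qform A v" "0::real" rule: linorder_cases)
    case less
    have "qform H v / qform A v \<le> a"
      unfolding a_def using R_ne ratio_le[OF _ less] by (intro cInf_greatest) (auto simp: R_def)
    then show ?thesis using less by (simp add: neg_divide_le_eq)
  next
    case equal
    then show ?thesis using imp[of v] by simp
  next
    case greater
    have "bdd_below R" using R_nonneg by (auto simp: bdd_below_def)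
    then have "a \<le> qform H v / qform A v"
      unfolding a_def using greater by (intro cInf_lower) (auto simp: R_def)
    then show ?thesis using greater by (simp add: le_divide_eq)
  qed
  then show ?thesis using a by blast
qed

lemma psd_form_cauchy_schwarz:
  fixes S :: "real^'n^'n"
  assumes psd: "\<And>v. qform S v \<ge> 0" and x: "qform S x > 0"
  shows "((z \<bullet> (S *v x) + x \<bullet> (S *v z)) / 2)\<^sup>2 \<le> qform S x * qform S z"
proof -
  define b where "b = (z \<bullet> (S *v x) + x \<bullet> (S *v z)) / 2"
  have "0 \<le> qform S (z - (b / qform S x) *\<^sub>R x)" by (rule psd)
  also have "\<dots> = qform S z - b\<^sup>2 / qform S x"
    using x by (simp add: qform_def b_def matrix_vector_mult_diff_distrib matrix_vector_mult_scaleR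
        inner_diff_left inner_diff_right field_simps power2_eq_square)
  finally show ?thesis using x by (simp add: b_def field_simps)
qed

text \<open>If x'Sx = 0 then c = 0 and any w with w \<bullet> x = 1 works. Otherwise w \<bullet> z is the
  symmetrised S-product of z and x divided by x'Sx, and Cauchy-Schwarz gives
  x'Sx (w \<bullet> z)^2 \<le> z'Sz, while -c \<le> x'Sx.\<close>

lemma psd_rank_one_update:
  fixes S :: "real^'n^'n"
  assumes psd: "\<And>v. qform S v \<ge> 0" and c: "c \<le> 0" and x: "x \<noteq> 0"
    and nonneg: "qform S x + c \<ge> 0"
  shows "\<exists>w. w \<bullet> x = 1 \<and> (\<forall>z. qform S z + c * (w \<bullet> z)\<^sup>2 \<ge> 0)"
proof (cases "qform S x = 0")
  case True
  then have "c = 0" using c nonneg by simp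
  moreover have "((1 / (x \<bullet> x)) *\<^sub>R x) \<bullet> x = 1" using x by simp
  ultimately show ?thesis using psd by (intro exI[of _ "(1 / (x \<bullet> x)) *\<^sub>R x"]) simp
next
  case False
  define s where "s = qform S x"
  have s: "s > 0" using False psd[of x] unfolding s_def by simp
  define w where "w = (1 / (2 * s)) *\<^sub>R (S *v x + transpose S *v x)"
  have wz: "w \<bullet> z = ((z \<bullet> (S *v x) + x \<bullet> (S *v z)) / 2) / s" for z
  proof -
    have "(transpose S *v x) \<bullet> z = x \<bullet> (S *v z)" by (rule inner_matrix_transpose[symmetric])
    then show ?thesis
      unfolding w_def inner_scaleR_left inner_add_left by (simp add: inner_commute)
  qed
  have "z \<bullet> (S *v x) + x \<bullet> (S *v z) = 2 * s" if "z = x" for z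
    using that by (simp add: s_def qform_def)
  then have "w \<bullet> x = 1" using wz[of x] s by simp
  moreover have "qform S z + c * (w \<bullet> z)\<^sup>2 \<ge> 0" for z
  proof -
    have "c * (w \<bullet> z)\<^sup>2 \<ge> - s * (w \<bullet> z)\<^sup>2"
      using nonneg by (intro mult_right_mono) (auto simp: s_def)
    moreover have "s * (w \<bullet> z)\<^sup>2 \<le> qform S z"
    proof -
      define b where "b = (z \<bullet> (S *v x) + x \<bullet> (S *v z)) / 2"
      have "s * (w \<bullet> z)\<^sup>2 = b\<^sup>2 / s" using s by (simp add: wz b_def power2_eq_square)
      also have "\<dots> \<le> qform S z"
        using psd_form_cauchy_schwarz[OF psd, of x z] s
        by (simp add: b_def s_def divide_le_eq mult.commute)
      finally show ?thesis .
    qed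
    ultimately show ?thesis by linarith
  qed
  ultimately show ?thesis by blast
qed

lemma nsd_qform_zero_imp_kernel:
  fixes A :: "real^'n^'n"
  assumes A: "symmetric_mat A" and nsd: "\<And>v. qform A v \<le> 0" and y: "qform A y = 0"
  shows "A *v y = 0"
proof -
  define z where "z = A *v y"
  define t where "t = (z \<bullet> z) / (1 - qform A z)"
  have "qform A (y + t *\<^sub>R z) = t * (2 * (z \<bullet> z) + t * qform A z)"
    using y symmetric_mat_inner_commute[OF A, of y z]
    by (simp add: qform_add_scaleR[OF A] z_def power2_eq_square algebra_simps)
  moreover have "t * qform A z \<ge> - (z \<bullet> z)"
    using nsd[of z] by (simp add: t_def field_simps)
  moreover have "t \<ge> 0" using nsd[of z] by (simp add: t_def)
  ultimately have "t * (z \<bullet> z) \<le> 0"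
    using nsd[of "y + t *\<^sub>R z"] by (smt (verit) mult_left_mono)
  moreover have "t > 0" if "z \<noteq> 0" using that nsd[of z] by (simp add: t_def)
  ultimately show ?thesis unfolding z_def[symmetric]
    by (metis inner_gt_zero_iff mult_pos_pos not_le)
qed

lemma qform_eq_norm_sgn: "qform A v = (norm v)\<^sup>2 * qform A (sgn v)"
proof -
  have "norm v *\<^sub>R sgn v = v" by (cases "v = 0") (simp_all add: sgn_div_norm)
  then show ?thesis by (metis qform_scaleR)
qed

lemma sgn_in_subspace_sphere:
  fixes W :: "'a::euclidean_space set"
  assumes "subspace W" "v \<in> W" "v \<noteq> 0"
  shows "sgn v \<in> W \<inter> sphere 0 1"
proof -
  have "sgn v \<in> W" using subspace_scale[OF assms(1,2)] by (simp add: sgn_div_norm)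
  then show ?thesis using assms(3) by (simp add: norm_sgn)
qed

lemma compact_subspace_sphere:
  fixes W :: "'a::euclidean_space set"
  assumes "subspace W"
  shows "compact (W \<inter> sphere 0 1)"
proof -
  have "compact (sphere 0 1 \<inter> W)"
    using compact_Int_closed compact_sphere closed_subspace[OF assms] by blast
  then show ?thesis by (simp add: Int_commute)
qed

lemma qform_le_on_subspace_if_sphere:
  fixes N H :: "real^'n^'n"
  assumes W: "subspace W" and sphere: "\<And>u. u \<in> W \<inter> sphere 0 1 \<Longrightarrow> a * qform N u \<le> qform H u"
    and "v \<in> W"
  shows "a * qform N v \<le> qform H v"
proof (cases "v = 0")
  case True then show ?thesis by (simp add: qform_def)
next
  case False
  then have "(norm v)\<^sup>2 * (a * qform N (sgn v)) \<le> (norm v)\<^sup>2 * qform H (sgn v)"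
    using sphere sgn_in_subspace_sphere[OF W \<open>v \<in> W\<close>] by (simp add: mult_left_mono)
  then show ?thesis using qform_eq_norm_sgn[of N v] qform_eq_norm_sgn[of H v] by (simp add: ac_simps)
qed

lemma qform_margin_on_subspace:
  fixes M N :: "real^'n^'n"
  assumes W: "subspace W"
    and pos: "\<And>v. v \<in> W \<Longrightarrow> v \<noteq> 0 \<Longrightarrow> qform N v \<ge> 0 \<Longrightarrow> qform M v > 0"
  shows "\<exists>b>0. \<forall>v\<in>W. qform N v \<ge> 0 \<longrightarrow> b * (norm v)\<^sup>2 \<le> qform M v"
proof -
  define K where "K = W \<inter> sphere 0 1 \<inter> {v. qform N v \<ge> 0}"
  have "compact K"
    unfolding K_def
    by (intro compact_Int_closed compact_subspace_sphere[OF W] closed_Collect_le continuous_on_qform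
        continuous_on_const)
  obtain b where b: "b > 0" and bK: "\<And>u. u \<in> K \<Longrightarrow> b \<le> qform M u"
  proof (cases "K = {}")
    case True then show ?thesis using that[of 1] by simp
  next
    case False
    obtain u0 where "u0 \<in> K" and "\<And>u. u \<in> K \<Longrightarrow> qform M u0 \<le> qform M u"
      using continuous_attains_inf[OF \<open>compact K\<close> False continuous_on_qform] by blast
    moreover have "u0 \<noteq> 0" using \<open>u0 \<in> K\<close> by (auto simp: K_def)
    then have "qform M u0 > 0" using \<open>u0 \<in> K\<close> pos unfolding K_def by blast
    ultimately show ?thesis using that by blast
  qed
  have "b * (norm v)\<^sup>2 \<le> qform M v" if "v \<in> W" "v \<noteq> 0" "qform N v \<ge> 0" for v
  proof -
    have "sgn v \<in> K"
      using sgn_in_subspace_sphere[OF W that(1,2)] that(2,3) qform_eq_norm_sgn[of N v]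
      by (auto simp: K_def zero_le_mult_iff)
    then show ?thesis
      using bK[of "sgn v"] qform_eq_norm_sgn[of M v] by (simp add: mult_right_mono mult.commute)
  qed
  moreover have "qform M 0 = 0" by (simp add: qform_def)
  ultimately show ?thesis using b by (metis norm_zero power2_eq_square mult_zero_right order_refl)
qed

lemma compact_nonpos_multiplier:
  fixes f h :: "'a::topological_space \<Rightarrow> real"
  assumes K: "compact K" and f: "continuous_on UNIV f" and h: "continuous_on UNIV h"
    and f_nonpos: "\<And>v. v \<in> K \<Longrightarrow> f v \<le> 0"
    and pos: "\<And>v. v \<in> K \<Longrightarrow> f v \<ge> 0 \<Longrightarrow> h v > 0"
  shows "\<exists>a\<ge>0. \<forall>v\<in>K. a * f v \<le> h v"
proof (cases "K \<inter> {v. h v \<le> 0} = {}")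
  case True
  then show ?thesis using f_nonpos by (intro exI[of _ 0]) force
next
  case False
  have "compact (K \<inter> {v. h v \<le> 0})"
    using K h by (intro compact_Int_closed closed_Collect_le continuous_on_const)
  then obtain v1 where v1: "v1 \<in> K" "h v1 \<le> 0"
    and v1_max: "\<And>v. v \<in> K \<Longrightarrow> h v \<le> 0 \<Longrightarrow> f v \<le> f v1"
    using continuous_attains_sup[OF _ False continuous_on_subset[OF f]] by blast
  have f1: "f v1 < 0" using f_nonpos[OF v1(1)] pos[OF v1(1)] v1(2) by force
  obtain v2 where "v2 \<in> K" and v2_min: "\<And>v. v \<in> K \<Longrightarrow> h v2 \<le> h v"
    using continuous_attains_inf[OF K _ continuous_on_subset[OF h]] v1(1) by blast
  define a where "a = h v2 / f v1"
  have "h v2 \<le> 0" using v2_min[OF v1(1)] v1(2) by simp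
  then have a: "a \<ge> 0" using f1 by (simp add: a_def divide_nonpos_neg)
  have "a * f v \<le> h v" if v: "v \<in> K" for v
  proof (cases "h v \<le> 0")
    case True
    then have "a * f v \<le> a * f v1" using a v1_max[OF v] by (simp add: mult_left_mono)
    also have "\<dots> = h v2" using f1 by (simp add: a_def)
    finally show ?thesis using v2_min[OF v] by simp
  next
    case False
    then show ?thesis using a f_nonpos[OF v] by (smt (verit) mult_nonneg_nonpos)
  qed
  then show ?thesis using a by blast
qed

text \<open>No Slater point is assumed: when N has no positive direction the multiplier comes from
  compactness of the unit sphere of W instead of the S-lemma, which is why the strict hypothesis
  on H is needed.\<close>

lemma strict_S_lemma_on_subspace:
  fixes N H :: "real^'n^'n"
  assumes N: "symmetric_mat N" and H: "symmetric_mat H" and W: "subspace W"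
    and reduce: "\<And>v. \<exists>w\<in>W. qform N w = qform N v \<and> qform H w = qform H v"
    and pos: "\<And>v. v \<in> W \<Longrightarrow> v \<noteq> 0 \<Longrightarrow> qform N v \<ge> 0 \<Longrightarrow> qform H v > 0"
  shows "\<exists>a\<ge>0. \<forall>v. a * qform N v \<le> qform H v"
proof (cases "\<exists>u. qform N u > 0")
  case True
  have "qform H v \<ge> 0" if "qform N v \<ge> 0" for v
  proof -
    obtain w where "w \<in> W" "qform N w = qform N v" "qform H w = qform H v"
      using reduce by blast
    then show ?thesis using pos[of w] that by (cases "w = 0") (simp_all add: qform_def)
  qed
  then show ?thesis using S_lemma[OF N H True] by blast
next
  case False
  define K where "K = W \<inter> sphere 0 1"
  have K: "compact K" unfolding K_def using W by (rule compact_subspace_sphere)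
  have N_nonpos: "qform N v \<le> 0" for v using False by (simp add: not_less)
  have H_pos: "qform H v > 0" if "v \<in> K" "qform N v \<ge> 0" for v
  proof -
    have "v \<noteq> 0" using that(1) by (auto simp: K_def)
    then show ?thesis using pos that by (simp add: K_def)
  qed
  obtain a where a: "a \<ge> 0" and aK: "\<And>v. v \<in> K \<Longrightarrow> a * qform N v \<le> qform H v"
    using compact_nonpos_multiplier[OF K continuous_on_qform continuous_on_qform N_nonpos H_pos]
    by blast
  have "a * qform N v \<le> qform H v" for v
  proof -
    obtain w where "w \<in> W" "qform N w = qform N v" "qform H w = qform H v"
      using reduce by blast
    then show ?thesis using qform_le_on_subspace_if_sphere[OF W aK[unfolded K_def]] by metis
  qed
  then show ?thesis using a by blast
qed

lemma PiSetD:
  assumes "N \<in> PiSet"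
  shows "symmetric_mat N" "\<And>y. qform (blk22 N) y \<le> 0" "\<And>x. qform (schur N) x \<ge> 0"
    "\<And>k. blk22 N *v k = 0 \<Longrightarrow> blk12 N *v k = 0"
  using assms by (auto simp: PiSet_def loewner_le_zero_iff psd_iff_qform ker_mat_def)

lemma PiSet_blk21_eq:
  assumes N: "N \<in> PiSet"
  shows "blk22 N ** pinv (blk22 N) ** blk21 N = blk21 N"
proof -
  let ?A = "blk22 N" and ?P = "pinv (blk22 N)"
  have A: "symmetric_mat ?A" using symmetric_mat_blocks(2)[OF PiSetD(1)[OF N]] .
  have "?A *v (k - ?P *v (?A *v k)) = 0" for k
    using pinv_symmetric_mat(1)[OF A]
    by (simp add: matrix_vector_mult_diff_distrib matrix_vector_mul_assoc matrix_mul_assoc)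
  then have "blk12 N *v k = (blk12 N ** ?P ** ?A) *v k" for k
    using PiSetD(4)[OF N]
    by (metis (no_types) eq_iff_diff_eq_0 matrix_vector_mult_diff_distrib matrix_vector_mul_assoc)
  then have "blk12 N = blk12 N ** ?P ** ?A" by (simp add: matrix_eq)
  then have "transpose (blk12 N) = transpose (blk12 N ** ?P ** ?A)" by simp
  then show ?thesis
    using A pinv_symmetric_mat(2)[OF A] symmetric_mat_blocks(1)[OF PiSetD(1)[OF N]]
    by (simp add: matrix_transpose_mul matrix_mul_assoc symmetric_mat_def)
qed

lemma qform_PiSet_schur:
  assumes N: "N \<in> PiSet"
  shows "qform N (vpair x y) =
    qform (schur N) x + qform (blk22 N) (y + pinv (blk22 N) *v (blk21 N *v x))"
proof -
  let ?A = "blk22 N" and ?P = "pinv (blk22 N)"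
  have A: "symmetric_mat ?A" using symmetric_mat_blocks(2)[OF PiSetD(1)[OF N]] .
  define p where "p = ?P *v (blk21 N *v x)"
  have Ap: "?A *v p = blk21 N *v x"
    using PiSet_blk21_eq[OF N] by (simp add: p_def matrix_vector_mul_assoc matrix_mul_assoc)
  have t12: "transpose (blk12 N) = blk21 N"
    using symmetric_mat_blocks(1)[OF PiSetD(1)[OF N]] .
  have "y \<bullet> (blk21 N *v x) = x \<bullet> (blk12 N *v y)"
    by (metis inner_commute inner_matrix_transpose t12)
  moreover have "p \<bullet> (blk21 N *v x) = x \<bullet> ((blk12 N ** ?P ** blk21 N) *v x)"
    unfolding p_def by (metis inner_commute inner_matrix_transpose t12 matrix_vector_mul_assoc)
  ultimately show ?thesis
    unfolding qform_vpair[OF PiSetD(1)[OF N]] qform_add[OF A] schur_def p_def[symmetric]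
    using Ap by (simp add: qform_def matrix_vector_mult_diff_rdistrib inner_diff_right)
qed

lemma outer_mult_vector: "(\<chi> i j. (d::real^'r) $ i * (w::real^'q) $ j) *v z = (w \<bullet> z) *\<^sub>R d"
  by (simp add: vec_eq_iff matrix_vector_mult_def inner_vec_def sum_distrib_left mult_ac)

text \<open>Z = d w' - N22\<dagger> N21 maps x to y, and along [I; Z] the Schur form of N becomes
  z'(N|N22)z + (w'z)^2 d'N22 d, which is nonnegative by the choice of w.\<close>

lemma PiSet_Zr_witness:
  fixes N :: "real^('q::finite+'r::finite)^('q+'r)"
  assumes N: "N \<in> PiSet" and x: "x \<noteq> 0" and nonneg: "qform N (vpair x y) \<ge> 0"
  shows "\<exists>Z\<in>Zr N. Z *v x = y"
proof -
  let ?A = "blk22 N" and ?P = "pinv (blk22 N)"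
  define d where "d = y + ?P *v (blk21 N *v x)"
  obtain w where wx: "w \<bullet> x = 1" and w: "\<And>z. qform (schur N) z + qform ?A d * (w \<bullet> z)\<^sup>2 \<ge> 0"
    using psd_rank_one_update[OF PiSetD(3)[OF N] PiSetD(2)[OF N] x] nonneg
    by (auto simp: qform_PiSet_schur[OF N] d_def)
  define Z :: "real^'q^'r" where "Z = (\<chi> i j. d $ i * w $ j) - ?P ** blk21 N"
  have Zz: "Z *v z = (w \<bullet> z) *\<^sub>R d - ?P *v (blk21 N *v z)" for z
    by (simp add: Z_def matrix_vector_mult_diff_rdistrib outer_mult_vector matrix_vector_mul_assoc)
  have "qform N (vpair z (Z *v z)) = qform (schur N) z + qform ?A d * (w \<bullet> z)\<^sup>2" for z
    by (simp add: qform_PiSet_schur[OF N] Zz qform_scaleR mult.commute)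
  then have "Z \<in> Zr N" using w by (simp add: Zr_def psd_iff_qform qform_stackI)
  moreover have "Z *v x = y" using Zz[of x] wx by (simp add: d_def)
  ultimately show ?thesis by blast
qed

lemma Zr_subset_Zr_plus_imp_qform_pos:
  assumes "N \<in> PiSet" "Zr N \<subseteq> Zr_plus M" "x \<noteq> 0" "qform N (vpair x y) \<ge> 0"
  shows "qform M (vpair x y) > 0"
proof -
  obtain Z where "Z \<in> Zr N" "Z *v x = y" using PiSet_Zr_witness assms(1,3,4) by blast
  then have "Z \<in> Zr_plus M" using assms(2) by blast
  then show ?thesis
    using \<open>Z *v x = y\<close> \<open>x \<noteq> 0\<close>
    by (auto simp: Zr_plus_def pd_def qform_stackI[unfolded qform_def, symmetric] qform_def)
qed

lemma linear_vsnd: "linear (vsnd :: real^('q::finite+'r::finite) \<Rightarrow> real^'r)"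
  by (rule linearI) simp_all

lemma PiSet_kernel_subset_kernel:
  fixes M N :: "real^('q::finite+'r::finite)^('q+'r)"
  assumes N: "N \<in> PiSet" and M: "symmetric_mat M" and M22: "\<And>y. qform (blk22 M) y \<le> 0"
    and pos: "\<And>x y. x \<noteq> 0 \<Longrightarrow> qform N (vpair x y) \<ge> 0 \<Longrightarrow> qform M (vpair x y) > 0"
    and k: "blk22 N *v k = 0"
  shows "blk22 M *v k = 0 \<and> blk12 M *v k = 0"
proof -
  have M22_sym: "symmetric_mat (blk22 M)" using symmetric_mat_blocks(2)[OF M] .
  have coeffs: "qform (blk22 M) k = 0 \<and> x \<bullet> (blk12 M *v k) + y0 \<bullet> (blk22 M *v k) = 0"
    if "x \<noteq> 0" and y0: "y0 = - (pinv (blk22 N) *v (blk21 N *v x))" for x y0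
  proof (rule quadratic_pos_nonpos_lead_imp_const[OF _ M22])
    fix t
    have "y0 + t *\<^sub>R k + pinv (blk22 N) *v (blk21 N *v x) = t *\<^sub>R k" by (simp add: y0)
    moreover have "qform (blk22 N) k = 0" by (simp add: qform_def k)
    ultimately have "qform N (vpair x (y0 + t *\<^sub>R k)) = qform (schur N) x"
      unfolding qform_PiSet_schur[OF N] by (simp only: qform_scaleR)
    then have "qform M (vpair x (y0 + t *\<^sub>R k)) > 0"
      using pos[OF \<open>x \<noteq> 0\<close>] PiSetD(3)[OF N] by simp
    then show "(qform (blk11 M) x + 2 * (x \<bullet> (blk12 M *v y0)) + qform (blk22 M) y0)
        + 2 * (x \<bullet> (blk12 M *v k) + y0 \<bullet> (blk22 M *v k)) * t + qform (blk22 M) k * t\<^sup>2 > 0"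
      unfolding qform_vpair[OF M] qform_add_scaleR[OF M22_sym]
      by (simp add: matrix_vector_right_distrib matrix_vector_mult_scaleR algebra_simps)
  qed
  have "(\<chi> i. 1) \<noteq> (0 :: real^'q)" by (simp add: vec_eq_iff)
  then have M22k: "blk22 M *v k = 0"
    using coeffs nsd_qform_zero_imp_kernel[OF M22_sym M22] by blast
  have "x \<bullet> (blk12 M *v k) = 0" for x
    using coeffs[of x] M22k by (cases "x = 0") auto
  then have "blk12 M *v k = 0" by (metis inner_eq_zero_iff)
  with M22k show ?thesis ..
qed

lemma PiSet_vfst_nonzero:
  fixes N :: "real^('q::finite+'r::finite)^('q+'r)"
  assumes N: "N \<in> PiSet" and v: "vsnd v \<in> range ((*v) (blk22 N))" "v \<noteq> 0" "qform N v \<ge> 0"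
  shows "vfst v \<noteq> 0"
proof
  let ?A = "blk22 N"
  have A: "symmetric_mat ?A" using symmetric_mat_blocks(2)[OF PiSetD(1)[OF N]] .
  assume "vfst v = 0"
  then have v0: "v = vpair 0 (vsnd v)" by (metis vpair_vfst_vsnd)
  then have "qform ?A (vsnd v) \<ge> 0"
    using v(3) qform_vpair[OF PiSetD(1)[OF N], of 0 "vsnd v"] by (simp add: qform_def)
  then have "?A *v vsnd v = 0"
    using nsd_qform_zero_imp_kernel[OF A PiSetD(2)[OF N]] PiSetD(2)[OF N, of "vsnd v"] by simp
  moreover obtain u where "vsnd v = ?A *v u" using v(1) by blast
  ultimately have "vsnd v = 0" using symmetric_mat_range_inter_kernel[OF A] by simp
  with v0 v(2) show False by simp
qed

lemma PiSet_qform_reduce_to_range: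
  fixes M N :: "real^('q::finite+'r::finite)^('q+'r)"
  assumes N: "N \<in> PiSet" and M: "symmetric_mat M"
    and kernel: "\<And>k. blk22 N *v k = 0 \<Longrightarrow> blk22 M *v k = 0 \<and> blk12 M *v k = 0"
  shows "\<exists>w. vsnd w \<in> range ((*v) (blk22 N)) \<and> vfst w = vfst v
    \<and> qform N w = qform N v \<and> qform M w = qform M v"
proof -
  let ?A = "blk22 N"
  obtain u where u: "?A *v (vsnd v - ?A *v u) = 0"
    using symmetric_mat_range_kernel_decomp[OF symmetric_mat_blocks(2)[OF PiSetD(1)[OF N]]] by blast
  define k where "k = vsnd v - ?A *v u"
  have k: "?A *v k = 0" using u by (simp add: k_def)
  have v: "v = vpair (vfst v) (?A *v u + k)" by (simp add: k_def)
  have "qform N v = qform N (vpair (vfst v) (?A *v u))"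
    by (subst v, rule qform_vpair_add_kernel[OF PiSetD(1)[OF N] PiSetD(4)[OF N k] k])
  moreover have "qform M v = qform M (vpair (vfst v) (?A *v u))"
    using kernel[OF k] by (subst v, intro qform_vpair_add_kernel[OF M]) simp_all
  ultimately show ?thesis by (intro exI[of _ "vpair (vfst v) (?A *v u)"]) simp
qed

lemma loewner_le_if_Zr_subset_Zr_plus:
  fixes M N :: "real^('q::finite+'r::finite)^('q+'r)"
  assumes M: "symmetric_mat M" and N: "N \<in> PiSet" and M22: "loewner_le (blk22 M) 0"
    and sub: "Zr N \<subseteq> Zr_plus M"
  shows "\<exists>a b. a \<ge> 0 \<and> b > 0 \<and> loewner_le (blkdiagI b) (M - a *\<^sub>R N)"
proof -
  have pos: "qform M (vpair x y) > 0" if "x \<noteq> 0" "qform N (vpair x y) \<ge> 0" for x y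
    using Zr_subset_Zr_plus_imp_qform_pos[OF N sub that] .
  have kernel: "blk22 M *v k = 0 \<and> blk12 M *v k = 0" if "blk22 N *v k = 0" for k
    using M22 pos that by (intro PiSet_kernel_subset_kernel[OF N M]) (auto simp: loewner_le_zero_iff)
  define W :: "(real^('q+'r)) set" where "W = vsnd -` range ((*v) (blk22 N))"
  have W: "subspace W"
    unfolding W_def by (intro linear_subspace_vimage linear_vsnd subspace_UNIV
        linear_subspace_image[OF matrix_vector_mul_linear])
  have "qform M v > 0" if "v \<in> W" "v \<noteq> 0" "qform N v \<ge> 0" for v
    using pos[of "vfst v" "vsnd v"] PiSet_vfst_nonzero[OF N] that by (simp add: W_def)
  then obtain b0 where b0: "b0 > 0"
    and margin: "\<And>v. v \<in> W \<Longrightarrow> qform N v \<ge> 0 \<Longrightarrow> b0 * (norm v)\<^sup>2 \<le> qform M v"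
    using qform_margin_on_subspace[OF W] by blast
  define b where "b = b0 / 2"
  define H where "H = M - blkdiagI b"
  have H: "symmetric_mat H" unfolding H_def using M symmetric_mat_blkdiagI by (rule symmetric_mat_diff)
  have qform_H: "qform H v = qform M v - b * (vfst v \<bullet> vfst v)" for v
    by (simp add: H_def qform_diff_matrix qform_blkdiagI)
  have H_pos: "qform H v > 0" if "v \<in> W" "v \<noteq> 0" "qform N v \<ge> 0" for v
  proof -
    have "vfst v \<bullet> vfst v \<le> (norm v)\<^sup>2"
      using inner_vfst_vsnd[of v v] by (simp add: power2_norm_eq_inner)
    then have "b * (vfst v \<bullet> vfst v) \<le> b * (norm v)\<^sup>2"
      using b0 by (simp add: b_def)
    moreover have "b * (norm v)\<^sup>2 < b0 * (norm v)\<^sup>2"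
      using b0 that(2) by (simp add: b_def)
    ultimately show ?thesis using margin[OF that(1,3)] unfolding qform_H by linarith
  qed
  have "\<exists>w\<in>W. qform N w = qform N v \<and> qform H w = qform H v" for v
    using PiSet_qform_reduce_to_range[OF N M kernel, of v] by (auto simp: W_def qform_H)
  then obtain a where "a \<ge> 0" and a: "\<And>v. a * qform N v \<le> qform H v"
    using strict_S_lemma_on_subspace[OF PiSetD(1)[OF N] H W _ H_pos] by blast
  have "loewner_le (blkdiagI b) (M - a *\<^sub>R N)"
    unfolding loewner_le_blkdiagI_iff using a by (simp add: qform_H algebra_simps)
  moreover have "b > 0" using b0 by (simp add: b_def)
  ultimately show ?thesis using \<open>a \<ge> 0\<close> by blast
qed

theorem mainTheorem13:
  fixes M N :: "real^('q::finite + 'r::finite)^('q + 'r)"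
  assumes "symmetric_mat M" and "symmetric_mat N"
  shows "((\<exists>\<alpha> \<beta>. \<alpha> \<ge> 0 \<and> \<beta> > 0 \<and> loewner_le (blkdiagI \<beta>) (M - \<alpha> *\<^sub>R N))
            \<longrightarrow> Zr N \<subseteq> Zr_plus M)
       \<and> (N \<in> PiSet \<and> loewner_le (blk22 M) 0 \<longrightarrow>
            (Zr N \<subseteq> Zr_plus M \<longleftrightarrow>
             (\<exists>\<alpha> \<beta>. \<alpha> \<ge> 0 \<and> \<beta> > 0 \<and> loewner_le (blkdiagI \<beta>) (M - \<alpha> *\<^sub>R N))))"
  using Zr_subset_Zr_plus_if_loewner_le loewner_le_if_Zr_subset_Zr_plus[OF assms(1)] by blast

end
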